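(* There exists an absolute constant $c>0$ such that the following holds. Let $n,r\in\mathbb{N}$ and let $\Delta:=n^{1/(r+1)}+2$ satisfy $\Delta\ge c^{-1}\log n$. Then there exists an $(n,\,c\,\Delta^{1+1/r}\log^{-1}n)$-expander which is not universal for $\mathcal{T}(n,\Delta)$.
   Context: For a graph $G$ and $X\subseteq V(G)$, $N_G(X)=\{y\in V(G)\setminus X:\exists x\in X,\{x,y\}\in E(G)\}$; $e_G(X,Y)$ is the number of ordered pairs $(x,y)\in X\times Y$ with $\{x,y\}\in E(G)$. With $m(n,d)=\lceil n/(2d)\rceil$, a graph $G$ is an $(n,d)$-expander if $|V(G)|=n$, $|N_G(X)|\ge d|X|$ for all $X\subseteq V(G)$ with $1\le|X|<m(n,d)$, and $e_G(X,Y)>0$ for all disjoint $X,Y\subseteq V(G)$ with $|X|=|Y|=m(n,d)$. $\mathcal{T}(n,\Delta)$ is the class of $n$-vertex trees with maximum degree at most $\Delta$; a graph is universal for a class if it contains a copy of every member. $\log$ is the natural logarithm. *)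

theory Defs
  imports Complex_Main
begin

text \<open>Finite simple graphs: an edge is a two-element set of vertices.\<close>

record 'v graph =
  verts :: "'v set"
  edges :: "'v set set"

definition simple_graph :: "'v graph \<Rightarrow> bool" where
  "simple_graph G \<longleftrightarrow>
     finite (verts G) \<and> edges G \<subseteq> {e. e \<subseteq> verts G \<and> card e = 2}"

definition neighbourhood :: "'v graph \<Rightarrow> 'v set \<Rightarrow> 'v set" where
  "neighbourhood G X = {y \<in> verts G - X. \<exists>x\<in>X. {x, y} \<in> edges G}"

definition edge_count :: "'v graph \<Rightarrow> 'v set \<Rightarrow> 'v set \<Rightarrow> nat" where
  "edge_count G X Y = card {(x, y). x \<in> X \<and> y \<in> Y \<and> {x, y} \<in> edges G}"

text \<open>The parameter \<open>d\<close> is real. In \<open>expander_threshold n d\<close> it is meant to be positive,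
  so that the ceiling is nonnegative and \<open>nat\<close> loses nothing.\<close>

definition expander_threshold :: "nat \<Rightarrow> real \<Rightarrow> nat" where
  "expander_threshold n d = nat \<lceil>real n / (2 * d)\<rceil>"

definition expander :: "nat \<Rightarrow> real \<Rightarrow> 'v graph \<Rightarrow> bool" where
  "expander n d G \<longleftrightarrow>
     simple_graph G \<and> card (verts G) = n \<and>
     (\<forall>X \<subseteq> verts G. 1 \<le> card X \<and> card X < expander_threshold n d \<longrightarrow>
        real (card (neighbourhood G X)) \<ge> d * real (card X)) \<and>
     (\<forall>X \<subseteq> verts G. \<forall>Y \<subseteq> verts G.
        X \<inter> Y = {} \<and> card X = expander_threshold n d \<and> card Y = expander_threshold n d \<longrightarrow>
        edge_count G X Y > 0)"

definition connected_graph :: "'v graph \<Rightarrow> bool" where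
  "connected_graph G \<longleftrightarrow> verts G \<noteq> {} \<and>
     (\<forall>u\<in>verts G. \<forall>v\<in>verts G. (u, v) \<in> {(x, y). {x, y} \<in> edges G}\<^sup>*)"

text \<open>A cycle is given by the list of its vertices, at least three and pairwise distinct;
  the edge joining the last vertex to the first is accounted for by the index modulo the length.\<close>

definition is_cycle :: "'v graph \<Rightarrow> 'v list \<Rightarrow> bool" where
  "is_cycle G p \<longleftrightarrow> length p \<ge> 3 \<and> distinct p \<and> set p \<subseteq> verts G \<and>
     (\<forall>i < length p. {p ! i, p ! (Suc i mod length p)} \<in> edges G)"

definition is_tree :: "'v graph \<Rightarrow> bool" where
  "is_tree G \<longleftrightarrow> simple_graph G \<and> connected_graph G \<and> (\<nexists>p. is_cycle G p)"

definition degree :: "'v graph \<Rightarrow> 'v \<Rightarrow> nat" where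
  "degree G v = card {w \<in> verts G. {v, w} \<in> edges G}"

definition max_degree :: "'v graph \<Rightarrow> nat" where
  "max_degree G = Max (degree G ` verts G)"

text \<open>The degree bound \<open>\<Delta>\<close> is real. Since trees are finite, those with vertices in \<open>nat\<close>
  represent all isomorphism types.\<close>

definition bounded_degree_trees :: "nat \<Rightarrow> real \<Rightarrow> nat graph set" where
  "bounded_degree_trees n \<Delta> =
     {T. is_tree T \<and> card (verts T) = n \<and> real (max_degree T) \<le> \<Delta>}"

text \<open>A copy is a not necessarily induced subgraph.\<close>

definition contains_copy :: "'v graph \<Rightarrow> 'w graph \<Rightarrow> bool" where
  "contains_copy G H \<longleftrightarrow> (\<exists>f. inj_on f (verts H) \<and> f ` verts H \<subseteq> verts G \<and>
     (\<forall>e\<in>edges H. f ` e \<in> edges G))"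

definition universal_for :: "'v graph \<Rightarrow> 'w graph set \<Rightarrow> bool" where
  "universal_for G C \<longleftrightarrow> (\<forall>H\<in>C. contains_copy G H)"

end

theory Submission
  imports Defs "HOL-Library.FuncSet"
begin

text \<open>Write \<open>n = k ^ (r + 1)\<close> and \<open>g v = v + 1 mod n\<close>. A \<open>\<lceil>k\<rceil>\<close>-ary tree on \<open>n\<close> vertices has
  maximum degree at most \<open>k + 2\<close> and every vertex is at distance at most \<open>r + 1\<close> from the root. So it
  suffices to find an expander in which no vertex \<open>v\<close> has distance at most \<open>r + 1\<close> from \<open>g v\<close>: the
  image of the root cannot be placed. Take a random graph of average degree \<open>D = 64 d ln n\<close>, and
  delete a maximal family of edge-disjoint paths of length at most \<open>r + 1\<close> from some \<open>v\<close> to \<open>g v\<close>.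
  Since \<open>D ^ r\<close> is at most a small multiple of \<open>n\<close>, a given edge is expected to lie on few of these
  paths, and the probability that the deletion removes every edge of the random graph
  inside a fixed set \<open>Q\<close> of pairs is at most \<open>exp (- p |Q| / 2)\<close> with \<open>p = D / n\<close>. This is small enough
  for a union bound over all pairs of vertex sets which are relevant to expansion. The union bound is
  delicate only when \<open>d\<close> is close to \<open>1\<close>, where it relies on \<open>(1 - 1 / d) ln n \<ge> ln k\<close>.\<close>

subsection \<open>Random sets and deletion of disjoint families\<close>

lemma sum_UN_le:
  fixes f :: "'b \<Rightarrow> real"
  assumes "finite I" "\<And>i. i \<in> I \<Longrightarrow> finite (A i)" "\<And>x. 0 \<le> f x"
  shows "sum f (\<Union>i\<in>I. A i) \<le> (\<Sum>i\<in>I. sum f (A i))"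
  using assms(1,2)
proof (induction I rule: finite_induct)
  case (insert i I)
  have "sum f (\<Union>j\<in>insert i I. A j) + sum f (A i \<inter> (\<Union>j\<in>I. A j)) = sum f (A i) + sum f (\<Union>j\<in>I. A j)"
    using insert by (simp add: sum.union_inter)
  moreover have "0 \<le> sum f (A i \<inter> (\<Union>j\<in>I. A j))"
    using assms(3) by (intro sum_nonneg)
  ultimately show ?case using insert by fastforce
qed simp

text \<open>The probability that a random subset of \<open>E\<close>, containing each element
  independently with probability \<open>p\<close>, equals \<open>S\<close>. Events are finite sets
  of outcomes and their probabilities finite sums, which avoids measure theory.\<close>

definition bernoulli_weight :: "real \<Rightarrow> 'a set \<Rightarrow> 'a set \<Rightarrow> real" where
  "bernoulli_weight p E S = p ^ card S * (1 - p) ^ card (E - S)"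

lemma bernoulli_weight_nonneg:
  "0 \<le> p \<Longrightarrow> p \<le> 1 \<Longrightarrow> 0 \<le> bernoulli_weight p E S"
  by (simp add: bernoulli_weight_def)

lemma bernoulli_weight_total:
  assumes "finite E"
  shows "(\<Sum>S\<in>Pow E. bernoulli_weight p E S) = 1"
  using prod_add[OF assms, of "\<lambda>_. p" "\<lambda>_. 1 - p"] by (simp add: bernoulli_weight_def)

text \<open>Writing \<open>S = A \<union> R\<close> with \<open>R \<subseteq> E - A - B\<close>
  splits off the prescribed factor; the weights of the free part \<open>R\<close> add up to
  1.\<close>

lemma bernoulli_weight_cylinder:
  assumes "finite E" "A \<subseteq> E" "B \<subseteq> E" "A \<inter> B = {}"
  shows "(\<Sum>S | S \<subseteq> E \<and> A \<subseteq> S \<and> S \<inter> B = {}. bernoulli_weight p E S) = p ^ card A * (1 - p) ^ card B"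
proof -
  let ?R = "E - A - B"
  have fin: "finite A" "finite B"
    using assms(1-3) by (auto intro: finite_subset)
  have "(\<Sum>S | S \<subseteq> E \<and> A \<subseteq> S \<and> S \<inter> B = {}. bernoulli_weight p E S) =
      (\<Sum>R\<in>Pow ?R. bernoulli_weight p E (A \<union> R))"
  proof (rule sum.reindex_bij_witness[where i="\<lambda>R. A \<union> R" and j="\<lambda>S. S - A"])
    fix S assume "S \<in> {S. S \<subseteq> E \<and> A \<subseteq> S \<and> S \<inter> B = {}}"
    then show "A \<union> (S - A) = S" "S - A \<in> Pow ?R"
        "bernoulli_weight p E (A \<union> (S - A)) = bernoulli_weight p E S"
      by (auto simp: Un_Diff_cancel Un_absorb1)
  next
    fix R assume "R \<in> Pow ?R"
    then show "A \<union> R - A = R" "A \<union> R \<in> {S. S \<subseteq> E \<and> A \<subseteq> S \<and> S \<inter> B = {}}"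
      using assms by auto
  qed
  also have "\<dots> = (\<Sum>R\<in>Pow ?R. p ^ card A * (1 - p) ^ card B * bernoulli_weight p ?R R)"
  proof (rule sum.cong[OF refl])
    fix R assume R: "R \<in> Pow ?R"
    then have finR: "finite R" using assms(1) by (meson PowD finite_Diff finite_subset)
    have "card (A \<union> R) = card A + card R"
      using R fin finR by (intro card_Un_disjoint) auto
    moreover have "E - (A \<union> R) = B \<union> (?R - R)" using assms R by auto
    moreover have "card (B \<union> (?R - R)) = card B + card (?R - R)"
      using assms fin by (intro card_Un_disjoint) auto
    ultimately show "bernoulli_weight p E (A \<union> R) =
        p ^ card A * (1 - p) ^ card B * bernoulli_weight p ?R R"
      by (simp add: bernoulli_weight_def power_add)
  qed
  also have "\<dots> = p ^ card A * (1 - p) ^ card B"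
    using bernoulli_weight_total[of ?R p] assms(1) by (simp flip: sum_distrib_left)
  finally show ?thesis .
qed

text \<open>Whenever a maximal edge-disjoint subfamily of the members of \<open>\<P>\<close> inside \<open>S\<close> covers
  \<open>S \<inter> Q\<close>, its members meeting \<open>Q\<close> witness that \<open>S\<close> is captured. Dropping maximality makes a union
  bound over all witnesses possible.\<close>

definition captured :: "'a set set \<Rightarrow> 'a set \<Rightarrow> 'a set \<Rightarrow> bool" where
  "captured \<P> Q S \<longleftrightarrow>
     (\<exists>F\<subseteq>{P\<in>\<P>. P \<inter> Q \<noteq> {}}. pairwise disjnt F \<and> \<Union>F \<subseteq> S \<and> S \<inter> Q \<subseteq> \<Union>F)"

text \<open>A witness \<open>F\<close> prescribes \<open>S\<close> on \<open>\<Union>F \<union> Q\<close>: all of \<open>\<Union>F\<close> is present and the rest of \<open>Q\<close> is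
  absent. Since at most \<open>s * card F\<close> elements of \<open>Q\<close> are excused from being absent, the sum over
  \<open>F\<close> is dominated by a product over the single members of \<open>\<P>\<close>.\<close>

lemma captured_weight:
  fixes p :: real
  assumes fin: "finite E" and Q: "Q \<subseteq> E"
    and \<P>: "\<And>P. P \<in> \<P> \<Longrightarrow> P \<subseteq> E \<and> card P \<le> s"
    and p: "0 < p" "p \<le> 1/2"
    and \<mu>: "2 ^ s * (\<Sum>P | P \<in> \<P> \<and> P \<inter> Q \<noteq> {}. p ^ card P) \<le> p * card Q / 2"
  shows "(\<Sum>S | S \<subseteq> E \<and> captured \<P> Q S. bernoulli_weight p E S) \<le> exp (- (p * card Q / 2))"
proof -
  let ?PQ = "{P. P \<in> \<P> \<and> P \<inter> Q \<noteq> {}}"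
  let ?FF = "{F\<in>Pow ?PQ. pairwise disjnt F}"
  let ?q = "1 - p"
  let ?c = "\<lambda>F. {S. S \<subseteq> E \<and> \<Union>F \<subseteq> S \<and> S \<inter> (Q - \<Union>F) = {}}"
  have finPQ: "finite ?PQ"
    by (rule finite_subset[of _ "Pow E"]) (use \<P> fin in auto)
  have finQ: "finite Q" using fin Q by (rule finite_subset[rotated])
  have nn: "0 \<le> bernoulli_weight p E S" for S
    using p by (intro bernoulli_weight_nonneg) auto
  have "(\<Sum>S | S \<subseteq> E \<and> captured \<P> Q S. bernoulli_weight p E S) \<le>
      (\<Sum>S\<in>(\<Union>F\<in>?FF. ?c F). bernoulli_weight p E S)"
  proof (rule sum_mono2)
    show "finite (\<Union>F\<in>?FF. ?c F)"
      by (rule finite_subset[of _ "Pow E"]) (use fin in auto)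
    show "{S. S \<subseteq> E \<and> captured \<P> Q S} \<subseteq> (\<Union>F\<in>?FF. ?c F)"
    proof
      fix S assume "S \<in> {S. S \<subseteq> E \<and> captured \<P> Q S}"
      then obtain F where "S \<subseteq> E" "F \<subseteq> ?PQ" "pairwise disjnt F" "\<Union>F \<subseteq> S" "S \<inter> Q \<subseteq> \<Union>F"
        unfolding captured_def by blast
      then have "F \<in> ?FF" "S \<in> ?c F" by auto
      then show "S \<in> (\<Union>F\<in>?FF. ?c F)" by blast
    qed
  qed (use nn in auto)
  also have "\<dots> \<le> (\<Sum>F\<in>?FF. \<Sum>S\<in>?c F. bernoulli_weight p E S)"
    by (rule sum_UN_le) (use fin finPQ nn in auto)
  also have "\<dots> \<le> (\<Sum>F\<in>?FF. ?q ^ card Q * (\<Prod>P\<in>F. 2 ^ s * p ^ card P))"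
  proof (rule sum_mono)
    fix F assume F: "F \<in> ?FF"
    have finF: "finite F" using F finPQ finite_subset by blast
    have UF: "\<Union>F \<subseteq> E" using F \<P> by blast
    have finP: "finite P" if "P \<in> F" for P using that F \<P> fin finite_subset by blast
    have card: "card (\<Union>F) = (\<Sum>P\<in>F. card P)"
      using F finP by (intro card_Union_disjoint) auto
    have "card (\<Union>F \<inter> Q) \<le> card (\<Union>F)"
      using UF fin finite_subset by (intro card_mono) auto
    also have "\<dots> \<le> s * card F"
      unfolding card using sum_bounded_above[of F card s] F \<P> by (auto simp: mult.commute)
    finally have "card (\<Union>F \<inter> Q) \<le> s * card F" .
    moreover have "card Q = card (\<Union>F \<inter> Q) + card (Q - \<Union>F)"
      using finQ by (metis Int_commute card_Int_Diff)
    ultimately have le: "card Q \<le> card (Q - \<Union>F) + s * card F" by simp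
    \<comment> \<open>At most \<open>s * card F\<close> factors \<open>?q\<close> are missing from
      \<open>?q ^ card Q\<close>. As \<open>?q \<ge> 1/2\<close>, supplying each of them costs at
      most a factor 2; this is the origin of \<open>2 ^ s\<close> in the hypothesis on the
      sum.\<close>
    have "?q ^ card (Q - \<Union>F) = ?q ^ card (Q - \<Union>F) * ((1/2) ^ (s * card F) * 2 ^ (s * card F))"
      by (simp add: power_one_over)
    also have "\<dots> \<le> ?q ^ card (Q - \<Union>F) * (?q ^ (s * card F) * 2 ^ (s * card F))"
      using p by (intro mult_left_mono mult_right_mono power_mono) auto
    also have "\<dots> = ?q ^ (card (Q - \<Union>F) + s * card F) * 2 ^ (s * card F)"
      by (simp add: power_add)
    also have "\<dots> \<le> ?q ^ card Q * 2 ^ (s * card F)"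
      using p le by (intro mult_right_mono power_decreasing) auto
    finally have *: "?q ^ card (Q - \<Union>F) \<le> ?q ^ card Q * 2 ^ (s * card F)" .
    have "(\<Sum>S\<in>?c F. bernoulli_weight p E S) = p ^ card (\<Union>F) * ?q ^ card (Q - \<Union>F)"
      by (rule bernoulli_weight_cylinder) (use fin UF Q in auto)
    also have "\<dots> \<le> p ^ card (\<Union>F) * (?q ^ card Q * 2 ^ (s * card F))"
      using p * by (intro mult_left_mono) auto
    also have "\<dots> = ?q ^ card Q * (\<Prod>P\<in>F. 2 ^ s * p ^ card P)"
      by (simp add: card power_sum prod.distrib power_mult)
    finally show "(\<Sum>S\<in>?c F. bernoulli_weight p E S) \<le> ?q ^ card Q * (\<Prod>P\<in>F. 2 ^ s * p ^ card P)" .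
  qed
  \<comment> \<open>Forgetting disjointness lets \<open>F\<close> range over all subsets, so the sum
    becomes an expanded product, to be bounded by \<open>1 + x \<le> exp x\<close>.\<close>
  also have "\<dots> \<le> (\<Sum>F\<in>Pow ?PQ. ?q ^ card Q * (\<Prod>P\<in>F. 2 ^ s * p ^ card P))"
    using p finPQ by (intro sum_mono2) (auto intro!: mult_nonneg_nonneg prod_nonneg)
  also have "\<dots> = ?q ^ card Q * (\<Prod>P\<in>?PQ. 2 ^ s * p ^ card P + 1)"
    using prod_add[OF finPQ, of "\<lambda>P. 2 ^ s * p ^ card P" "\<lambda>_. 1"]
    by (simp add: sum_distrib_left)
  also have "\<dots> \<le> exp (- p) ^ card Q * (\<Prod>P\<in>?PQ. exp (2 ^ s * p ^ card P))"
  proof (intro mult_mono power_mono prod_mono conjI)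
    show "?q \<le> exp (- p)" using exp_ge_add_one_self[of "-p"] by simp
  qed (use p in \<open>auto intro!: prod_nonneg simp: add.commute\<close>)
  also have "\<dots> = exp (- (p * card Q) + 2 ^ s * (\<Sum>P\<in>?PQ. p ^ card P))"
    unfolding exp_add sum_distrib_left exp_sum[OF finPQ]
    by (simp add: mult.commute flip: exp_of_nat_mult)
  also have "\<dots> \<le> exp (- (p * card Q / 2))"
    using \<mu> by simp
  finally show ?thesis .
qed

text \<open>Union bound: if every \<open>S\<close> were captured for some \<open>i\<close>, the
  total weight 1 would be at most the sum of the \<open>w i\<close>.\<close>

lemma exists_uncaptured:
  fixes p :: real
  assumes fin: "finite E" "finite I" and p: "0 \<le> p" "p \<le> 1"
    and bound: "\<And>i. i \<in> I \<Longrightarrow> (\<Sum>S | S \<subseteq> E \<and> captured \<P> (Q i) S. bernoulli_weight p E S) \<le> w i"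
    and small: "(\<Sum>i\<in>I. w i) < 1"
  obtains S where "S \<subseteq> E" "\<And>i. i \<in> I \<Longrightarrow> \<not> captured \<P> (Q i) S"
proof -
  have nn: "0 \<le> bernoulli_weight p E S" for S
    using p by (intro bernoulli_weight_nonneg) auto
  have "\<exists>S\<subseteq>E. \<forall>i\<in>I. \<not> captured \<P> (Q i) S"
  proof (rule ccontr)
    assume "\<not> ?thesis"
    then have "Pow E \<subseteq> (\<Union>i\<in>I. {S. S \<subseteq> E \<and> captured \<P> (Q i) S})" by auto
    then have "(\<Sum>S\<in>Pow E. bernoulli_weight p E S) \<le>
        (\<Sum>S\<in>(\<Union>i\<in>I. {S. S \<subseteq> E \<and> captured \<P> (Q i) S}). bernoulli_weight p E S)"
      using fin nn by (intro sum_mono2) auto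
    also have "\<dots> \<le> (\<Sum>i\<in>I. \<Sum>S | S \<subseteq> E \<and> captured \<P> (Q i) S. bernoulli_weight p E S)"
      by (rule sum_UN_le) (use fin nn in auto)
    also have "\<dots> \<le> (\<Sum>i\<in>I. w i)" by (rule sum_mono) (rule bound)
    finally show False using small bernoulli_weight_total[OF fin(1), of p] by simp
  qed
  then show thesis using that by blast
qed

text \<open>\<open>G\<close> is \<open>S\<close> minus a maximal disjoint family of members of
  \<open>\<P>\<close> inside \<open>S\<close>. If nothing of \<open>Q i\<close> survived, the
  members meeting \<open>Q i\<close> would witness capture. A nonempty member of \<open>\<P>\<close>
  surviving in \<open>G\<close> could be added to the family, against maximality.\<close>

lemma prune_uncaptured:
  assumes fin: "finite S" and ne: "{} \<notin> \<P>"
    and unc: "\<And>i. i \<in> I \<Longrightarrow> \<not> captured \<P> (Q i) S"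
  obtains G where "G \<subseteq> S" "\<And>i. i \<in> I \<Longrightarrow> G \<inter> Q i \<noteq> {}" "\<And>P. P \<in> \<P> \<Longrightarrow> \<not> P \<subseteq> G"
proof -
  define A where "A = {F. F \<subseteq> {P\<in>\<P>. P \<subseteq> S} \<and> pairwise disjnt F}"
  have "finite A"
    unfolding A_def by (rule finite_subset[of _ "Pow (Pow S)"]) (use fin in auto)
  moreover have "A \<noteq> {}" unfolding A_def by (metis (mono_tags, lifting) empty_iff empty_subsetI mem_Collect_eq pairwise_empty)
  ultimately obtain F where "F \<in> A" and max: "\<forall>F'\<in>A. F \<subseteq> F' \<longrightarrow> F = F'"
    using finite_has_maximal by blast
  then have F: "F \<subseteq> {P\<in>\<P>. P \<subseteq> S}" "pairwise disjnt F" unfolding A_def by auto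
  show thesis
  proof (rule that[of "S - \<Union>F"])
    fix i assume i: "i \<in> I"
    show "(S - \<Union>F) \<inter> Q i \<noteq> {}"
    proof
      assume e: "(S - \<Union>F) \<inter> Q i = {}"
      have "captured \<P> (Q i) S"
        unfolding captured_def
      proof (intro exI[of _ "{P\<in>F. P \<inter> Q i \<noteq> {}}"] conjI)
        show "pairwise disjnt {P \<in> F. P \<inter> Q i \<noteq> {}}"
          using F by (auto simp: pairwise_def)
        show "S \<inter> Q i \<subseteq> \<Union>{P \<in> F. P \<inter> Q i \<noteq> {}}" using e by blast
      qed (use F in auto)
      then show False using unc[OF i] by blast
    qed
  next
    fix P assume P: "P \<in> \<P>"
    show "\<not> P \<subseteq> S - \<Union>F"
    proof
      assume PS: "P \<subseteq> S - \<Union>F"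
      have "disjnt P P'" if "P' \<in> F" for P' using PS that by (auto simp: disjnt_def)
      then have "insert P F \<in> A"
        unfolding A_def using F P PS by (auto simp: pairwise_insert disjnt_sym)
      then have "F = insert P F" using max by (meson subset_insertI)
      then have "P \<in> F" by auto
      moreover have "P \<noteq> {}" using ne P by auto
      ultimately show False using PS by blast
    qed
  qed (rule Diff_subset)
qed

subsection \<open>Short linking paths\<close>

definition path_edges :: "(nat \<Rightarrow> 'v) \<Rightarrow> nat \<Rightarrow> 'v set set" where
  "path_edges h l = (\<lambda>i. {h i, h (Suc i)}) ` {..<l}"

text \<open>The single edge from \<open>v\<close> to \<open>g v\<close> is excluded here; it never occurs because it is not among
  the \<open>admissible_pairs\<close> below.\<close>

definition linking_paths :: "('v \<Rightarrow> 'v) \<Rightarrow> 'v set \<Rightarrow> nat \<Rightarrow> 'v set set set" where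
  "linking_paths g V s = {path_edges h l | h l.
     2 \<le> l \<and> l \<le> s \<and> h ` {..l} \<subseteq> V \<and> inj_on h {..l} \<and> h l = g (h 0)}"

lemma card_path_edges:
  assumes "inj_on h {..l}"
  shows "card (path_edges h l) = l"
proof -
  have "inj_on (\<lambda>i. {h i, h (Suc i)}) {..<l}"
  proof (rule inj_onI)
    fix i j assume ij: "i \<in> {..<l}" "j \<in> {..<l}" "{h i, h (Suc i)} = {h j, h (Suc j)}"
    then have "h i = h j \<and> h (Suc i) = h (Suc j) \<or> h i = h (Suc j) \<and> h (Suc i) = h j"
      by (auto simp: doubleton_eq_iff)
    then have "i = j \<or> i = Suc j \<and> Suc i = j"
      using ij(1,2) inj_onD[OF assms] by (metis Suc_leI atMost_iff lessThan_iff less_imp_le)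
    then show "i = j" by linarith
  qed
  then show ?thesis by (simp add: path_edges_def card_image)
qed

lemma card_PiE_two_prescribed:
  assumes "i < l" "j < l" "i \<noteq> j"
  shows "card (PiE {..<l} (\<lambda>k. if k = i then {a} else if k = j then {b} else V)) = card V ^ (l - 2)"
proof -
  have "card (PiE {..<l} (\<lambda>k. if k = i then {a} else if k = j then {b} else V)) =
      (\<Prod>k<l. if k \<in> {i, j} then 1 else card V)"
    by (subst card_PiE) (auto intro!: prod.cong)
  also have "\<dots> = (\<Prod>k\<in>{..<l} - {i, j}. card V)"
    by (rule prod.mono_neutral_cong_right) auto
  also have "card ({..<l} - {i, j}) = l - 2"
    using assms by (subst card_Diff_subset) auto
  then have "(\<Prod>k\<in>{..<l} - {i, j}. card V) = card V ^ (l - 2)" by simp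
  finally show ?thesis .
qed

lemma card_ordered_pairs_le:
  assumes "finite Q" "\<And>e. e \<in> Q \<Longrightarrow> card e = 2"
  shows "finite {(a, b). {a, b} \<in> Q}" "card {(a, b). {a, b} \<in> Q} \<le> 2 * card Q"
proof -
  have *: "finite {(a, b). {a, b} = e} \<and> card {(a, b). {a, b} = e} \<le> 2" if e: "e \<in> Q" for e
  proof -
    obtain u v where uv: "e = {u, v}" using assms(2)[OF e] by (auto simp: card_2_iff)
    have "{(a, b). {a, b} = e} \<subseteq> {(u, v), (v, u)}"
      unfolding uv by (auto simp: doubleton_eq_iff)
    moreover have "card {(u, v), (v, u)} \<le> 2" using card_length[of "[(u, v), (v, u)]"] by simp
    ultimately show ?thesis
      using card_mono[of "{(u, v), (v, u)}" "{(a, b). {a, b} = e}"]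
        finite_subset[of "{(a, b). {a, b} = e}" "{(u, v), (v, u)}"] by simp
  qed
  have eq: "{(a, b). {a, b} \<in> Q} = (\<Union>e\<in>Q. {(a, b). {a, b} = e})" by auto
  show "finite {(a, b). {a, b} \<in> Q}" unfolding eq using assms(1) * by auto
  have "card {(a, b). {a, b} \<in> Q} \<le> (\<Sum>e\<in>Q. card {(a, b). {a, b} = e})"
    unfolding eq by (rule card_UN_le[OF assms(1)])
  also have "\<dots> \<le> (\<Sum>e\<in>Q. 2)" by (rule sum_mono) (use * in auto)
  finally show "card {(a, b). {a, b} \<in> Q} \<le> 2 * card Q" by simp
qed

text \<open>An edge together with the condition \<open>h l = g (h 0)\<close> determines three of the \<open>l + 1\<close> vertices,
  since the edge cannot contain both \<open>h 0\<close> and \<open>h l\<close>.\<close>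

lemma card_linking_maps_le:
  fixes a b :: "'v"
  assumes V: "finite V" and g: "inj_on g V" and l: "2 \<le> l" "i < l"
  defines "H \<equiv> {h \<in> {..l} \<rightarrow>\<^sub>E V. h i = a \<and> h (Suc i) = b \<and> h l = g (h 0)}"
  shows "card H \<le> card V ^ (l - 2)"
proof -
  have fin: "finite (PiE {..<l} (\<lambda>k. if k = i then {a} else if k = j then {c} else V))" for j c
    using V by (intro finite_PiE) auto
  have inj: "inj_on (\<lambda>h. restrict h {..<l}) H"
  proof (rule inj_onI)
    fix h h' assume h: "h \<in> H" "h' \<in> H" "restrict h {..<l} = restrict h' {..<l}"
    then have eq: "h k = h' k" if "k < l" for k using that by (metis lessThan_iff restrict_apply')
    then have "h l = h' l" using h l by (auto simp: H_def)
    then have "h k = h' k" if "k \<in> {..l}" for k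
      using eq that by (cases "k = l") auto
    then show "h = h'" using h(1,2) unfolding H_def by (blast intro: PiE_ext)
  qed
  show ?thesis
  proof (cases "Suc i < l")
    case True
    have "(\<lambda>h. restrict h {..<l}) ` H \<subseteq> PiE {..<l} (\<lambda>k. if k = i then {a} else if k = Suc i then {b} else V)"
      unfolding H_def by (auto simp: PiE_iff extensional_def split: if_splits)
    then have "card H \<le> card (PiE {..<l} (\<lambda>k. if k = i then {a} else if k = Suc i then {b} else V))"
      using card_inj_on_le[OF inj _ fin] by blast
    then show ?thesis using True l by (simp add: card_PiE_two_prescribed)
  next
    case False
    \<comment> \<open>The prescribed edge ends at \<open>h l\<close>, so its end
      \<open>b = g (h 0)\<close> determines \<open>h 0\<close> by injectivity of \<open>g\<close>.
      Since \<open>l \<ge> 2\<close>, the positions 0 and \<open>i\<close> differ.\<close>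
    then have i: "Suc i = l" using l by simp
    define c where "c = the_inv_into V g b"
    have "h 0 = c" if h: "h \<in> H" for h
    proof -
      have "h 0 \<in> V" "b = g (h 0)" using h i unfolding H_def by (auto simp: PiE_iff)
      then show ?thesis using the_inv_into_f_f[OF g] by (simp add: c_def)
    qed
    then have "(\<lambda>h. restrict h {..<l}) ` H \<subseteq> PiE {..<l} (\<lambda>k. if k = i then {a} else if k = 0 then {c} else V)"
      unfolding H_def by (auto simp: PiE_iff extensional_def split: if_splits)
    then have "card H \<le> card (PiE {..<l} (\<lambda>k. if k = i then {a} else if k = 0 then {c} else V))"
      using card_inj_on_le[OF inj _ fin] by blast
    then show ?thesis using i l by (simp add: card_PiE_two_prescribed)
  qed
qed

text \<open>A path meeting \<open>Q\<close> is obtained by choosing a position for an edge of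
  \<open>Q\<close> (\<open>l\<close> ways), an orientation of that edge (at most
  \<open>2 * card Q\<close> ordered pairs), and a map with these two consecutive values.\<close>

lemma card_linking_paths_le:
  assumes V: "finite V" and g: "inj_on g V"
    and Q: "finite Q" "\<And>e. e \<in> Q \<Longrightarrow> card e = 2" and l: "2 \<le> l"
  shows "card {P \<in> linking_paths g V s. P \<inter> Q \<noteq> {} \<and> card P = l} \<le> l * (2 * card Q * card V ^ (l - 2))"
    (is "card ?L \<le> _")
proof -
  let ?O = "{(a, b). {a, b} \<in> Q}"
  let ?H = "\<lambda>i e. {h \<in> {..l} \<rightarrow>\<^sub>E V. h i = fst e \<and> h (Suc i) = snd e \<and> h l = g (h 0)}"
  let ?I = "\<lambda>i e. (\<lambda>h. path_edges h l) ` ?H i e"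
  have finH: "finite (?H i e)" for i e
    by (rule finite_subset[of _ "{..l} \<rightarrow>\<^sub>E V"]) (use V in \<open>auto intro!: finite_PiE\<close>)
  have cardI: "card (?I i e) \<le> card V ^ (l - 2)" if "i < l" for i e
    using card_image_le[OF finH, of "\<lambda>h. path_edges h l" i e]
      card_linking_maps_le[OF V g l that, of "fst e" "snd e"] by simp
  have "?L \<subseteq> (\<Union>i\<in>{..<l}. \<Union>e\<in>?O. ?I i e)"
  proof
    fix P assume P: "P \<in> ?L"
    then obtain h l' where h: "P = path_edges h l'" "h ` {..l'} \<subseteq> V" "inj_on h {..l'}" "h l' = g (h 0)"
      unfolding linking_paths_def by blast
    then have l': "l' = l" using P card_path_edges[OF h(3)] by simp
    obtain i where i: "i < l" "{h i, h (Suc i)} \<in> Q"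
      using P h(1) l' by (auto simp: path_edges_def)
    have "path_edges (restrict h {..l}) l = P"
      unfolding h(1) l' path_edges_def by (intro image_cong) auto
    moreover have "restrict h {..l} \<in> ?H i (h i, h (Suc i))"
      using h i unfolding l' by auto
    ultimately have "P \<in> ?I i (h i, h (Suc i))" by (metis (no_types, lifting) imageI)
    then show "P \<in> (\<Union>i\<in>{..<l}. \<Union>e\<in>?O. ?I i e)" using i by blast
  qed
  then have "card ?L \<le> card (\<Union>i\<in>{..<l}. \<Union>e\<in>?O. ?I i e)"
    by (rule card_mono[rotated]) (use finH card_ordered_pairs_le[OF Q] in auto)
  also have "\<dots> \<le> (\<Sum>i<l. card (\<Union>e\<in>?O. ?I i e))" by (rule card_UN_le) simp
  also have "\<dots> \<le> (\<Sum>i<l. 2 * card Q * card V ^ (l - 2))"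
  proof (rule sum_mono)
    fix i assume i: "i \<in> {..<l}"
    have "card (\<Union>e\<in>?O. ?I i e) \<le> (\<Sum>e\<in>?O. card (?I i e))"
      by (rule card_UN_le) (rule card_ordered_pairs_le[OF Q])
    also have "\<dots> \<le> (\<Sum>e\<in>?O. card V ^ (l - 2))"
      using i by (intro sum_mono cardI) auto
    also have "\<dots> \<le> 2 * card Q * card V ^ (l - 2)"
      using card_ordered_pairs_le(2)[OF Q] by simp
    finally show "card (\<Union>e\<in>?O. ?I i e) \<le> 2 * card Q * card V ^ (l - 2)" .
  qed
  finally show ?thesis by simp
qed

text \<open>With \<open>p = D / n\<close>, length \<open>l\<close> contributes at most
  \<open>l * 2 * card Q * n ^ (l - 2) * p ^ l\<close>, which is
  \<open>2 * l * card Q * D ^ (l - 1) / n * p\<close>. As \<open>D \<ge> 1\<close>, each of the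
  \<open>r\<close> possible lengths is bounded by the value at \<open>l = r + 1\<close>.\<close>

lemma linking_paths_weight:
  fixes D :: real
  assumes V: "finite V" "V \<noteq> {}" and g: "inj_on g V"
    and Q: "finite Q" "\<And>e. e \<in> Q \<Longrightarrow> card e = 2" and D: "1 \<le> D" and p: "p = D / card V"
  shows "(\<Sum>P | P \<in> linking_paths g V (Suc r) \<and> P \<inter> Q \<noteq> {}. p ^ card P)
    \<le> 2 * real r * real (Suc r) * D ^ r / card V * (p * card Q)"
proof -
  let ?n = "real (card V)"
  let ?L = "{P \<in> linking_paths g V (Suc r). P \<inter> Q \<noteq> {}}"
  have n: "?n > 0" using V by (simp add: card_gt_0_iff)
  have finL: "finite ?L"
  proof (rule finite_subset[of _ "Pow (Pow V)"])
    show "?L \<subseteq> Pow (Pow V)"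
      by (auto simp: linking_paths_def path_edges_def image_subset_iff)
  qed (use V in auto)
  have range: "card ` ?L \<subseteq> {2..Suc r}"
    by (auto simp: linking_paths_def card_path_edges)
  have "(\<Sum>P\<in>?L. p ^ card P) = (\<Sum>l\<in>{2..Suc r}. \<Sum>P | P \<in> ?L \<and> card P = l. p ^ card P)"
    using sum.group[OF finL _ range, of "\<lambda>P. p ^ card P"] by simp
  also have "\<dots> \<le> (\<Sum>l\<in>{2..Suc r}. real (Suc r) * (2 * card Q * (D ^ r / ?n * p)))"
  proof (rule sum_mono)
    fix l assume l: "l \<in> {2..Suc r}"
    then obtain j where j: "l = Suc (Suc j)" by (metis One_nat_def Suc_1 atLeastAtMost_iff le_Suc_ex add_Suc plus_1_eq_Suc)
    have eq: "{P \<in> ?L. card P = l} = {P \<in> linking_paths g V (Suc r). P \<inter> Q \<noteq> {} \<and> card P = l}" by auto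
    have "real (card {P \<in> ?L. card P = l}) \<le> real (l * (2 * card Q * card V ^ (l - 2)))"
      unfolding eq using l by (intro of_nat_mono card_linking_paths_le[OF V(1) g Q]) auto
    then have "(\<Sum>P | P \<in> ?L \<and> card P = l. p ^ card P) \<le> real (l * (2 * card Q * card V ^ (l - 2))) * p ^ l"
      using n D by (simp add: p mult_right_mono)
    also have "\<dots> = real l * (2 * card Q * (D ^ Suc j / ?n * p))"
      using n unfolding p j by (simp add: field_simps)
    also have "\<dots> \<le> real (Suc r) * (2 * card Q * (D ^ r / ?n * p))"
      using l D n unfolding p
      by (intro mult_mono mult_left_mono mult_right_mono divide_right_mono power_increasing) (auto simp: j)
    finally show "(\<Sum>P | P \<in> ?L \<and> card P = l. p ^ card P) \<le> real (Suc r) * (2 * card Q * (D ^ r / ?n * p))" .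
  qed
  also have "\<dots> = 2 * real r * real (Suc r) * D ^ r / ?n * (p * card Q)"
    by (simp add: field_simps)
  finally show ?thesis by (simp add: conj_commute)
qed

subsection \<open>Expanders without short linking paths\<close>

definition admissible_pairs :: "('v \<Rightarrow> 'v) \<Rightarrow> 'v set \<Rightarrow> 'v set set" where
  "admissible_pairs g V = {{u, v} | u v. u \<in> V \<and> v \<in> V \<and> u \<noteq> v \<and> v \<noteq> g u \<and> u \<noteq> g v}"

definition cross_pairs :: "('v \<Rightarrow> 'v) \<Rightarrow> 'v set \<Rightarrow> 'v set \<Rightarrow> 'v set \<Rightarrow> 'v set set" where
  "cross_pairs g V X Y = {e \<in> admissible_pairs g V. \<exists>x\<in>X. \<exists>y\<in>Y. e = {x, y}}"

lemma admissible_pairsD: "e \<in> admissible_pairs g V \<Longrightarrow> e \<subseteq> V \<and> card e = 2"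
  by (auto simp: admissible_pairs_def)

text \<open>Each \<open>x\<close> lies in at most two inadmissible pairs, one with
  \<open>y = g x\<close> and, \<open>g\<close> being injective, one with \<open>x = g y\<close>.
  Since \<open>card Y \<ge> 4\<close>, at least half of all pairs remain.\<close>

lemma card_cross_pairs_ge:
  assumes V: "finite V" and g: "inj_on g V" and XY: "X \<subseteq> V" "Y \<subseteq> V" "X \<inter> Y = {}" and Y: "4 \<le> card Y"
  shows "card X * card Y \<le> 2 * card (cross_pairs g V X Y)"
proof -
  have fin: "finite X" "finite Y" using V XY by (auto intro: finite_subset)
  let ?A = "{(x, y) \<in> X \<times> Y. {x, y} \<in> admissible_pairs g V}"
  let ?B = "(\<lambda>x. (x, g x)) ` X"
  let ?C = "{(x, y) \<in> X \<times> Y. x = g y}"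
  have sub: "X \<times> Y \<subseteq> ?A \<union> ?B \<union> ?C"
  proof
    fix e assume "e \<in> X \<times> Y"
    then obtain x y where e: "e = (x, y)" "x \<in> X" "y \<in> Y" by blast
    then have "x \<in> V" "y \<in> V" "x \<noteq> y" using XY by auto
    then show "e \<in> ?A \<union> ?B \<union> ?C"
      using e by (cases "y = g x \<or> x = g y") (auto simp: admissible_pairs_def)
  qed
  have finABC: "finite ?A" "finite ?B" "finite ?C"
    by (auto intro: finite_subset[of _ "X \<times> Y"] simp: fin)
  have finE: "finite (cross_pairs g V X Y)"
    by (rule finite_subset[of _ "Pow V"]) (use V admissible_pairsD in \<open>auto simp: cross_pairs_def\<close>)
  have "inj_on (\<lambda>(x, y). {x, y}) ?A"
    using XY(3) by (auto simp: inj_on_def doubleton_eq_iff)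
  then have A: "card ?A \<le> card (cross_pairs g V X Y)"
    by (rule card_inj_on_le[OF _ _ finE]) (auto simp: cross_pairs_def)
  have B: "card ?B \<le> card X" by (rule card_image_le[OF fin(1)])
  have "inj_on fst ?C" using g XY(2) by (auto simp: inj_on_def)
  then have C: "card ?C \<le> card X"
    by (rule card_inj_on_le[OF _ _ fin(1)]) auto
  have "card X * card Y = card (X \<times> Y)" by (simp add: card_cartesian_product)
  also have "\<dots> \<le> card (?A \<union> ?B \<union> ?C)" using sub finABC by (intro card_mono) auto
  also have "\<dots> \<le> card ?A + card ?B + card ?C"
    using card_Un_le[of "?A \<union> ?B" ?C] card_Un_le[of ?A ?B] by linarith
  also have "\<dots> \<le> card (cross_pairs g V X Y) + 2 * card X" using A B C by linarith
  finally have "card X * card Y \<le> card (cross_pairs g V X Y) + 2 * card X" .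
  moreover have "4 * card X \<le> card X * card Y" using Y by simp
  ultimately show ?thesis by linarith
qed

section \<open>Summing the failure probabilities over pairs of vertex sets\<close>

lemma sum_Pow_power_card:
  fixes a :: real
  assumes "finite V"
  shows "(\<Sum>A\<in>Pow V. a ^ card A) = (1 + a) ^ card V"
  using prod_add[OF assms, of "\<lambda>_. a" "\<lambda>_. 1"] by (simp add: add.commute)

text \<open>The first term factors over \<open>A\<close> and \<open>B\<close> into
  \<open>(s - 1) * s\<close> with \<open>s = (1 + n ^ (-4)) ^ n\<close> close to 1, the nonemptiness
  of \<open>A\<close> removing the large part. The second term meets at most \<open>4 ^ n\<close>
  pairs. The bound is 1/2 because two kinds of failure will be added.\<close>

lemma union_bound_weights:
  fixes L :: real
  assumes V: "finite V" "V \<noteq> {}" and L: "L = ln (card V)" "8 \<le> L"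
  shows "(\<Sum>(A, B)\<in>(Pow V - {{}}) \<times> Pow V. exp (- 4 * L * (card A + card B)) + exp (- 4 * card V)) < 1/2"
proof -
  let ?n = "card V"
  define a where "a = exp (- 4 * L)"
  define s where "s = (1 + a) ^ ?n"
  have n: "0 < ?n" using V by (simp add: card_gt_0_iff)
  have expL: "real ?n = exp L" using n L(1) by simp
  have "real ?n * a = exp (- 3 * L)" unfolding expL a_def by (simp flip: exp_add)
  also have "\<dots> \<le> exp (- 24)" using L(2) by simp
  also have "\<dots> \<le> 1/25" using exp_ge_add_one_self[of 24] by (simp add: exp_minus field_simps)
  finally have na: "real ?n * a \<le> 1/25" .
  have "s \<le> exp a ^ ?n" unfolding s_def a_def by (intro power_mono) auto
  also have "\<dots> = exp (real ?n * a)" by (simp add: exp_of_nat_mult)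
  also have "\<dots> \<le> exp (1/25)" using na by simp
  also have "\<dots> \<le> 1 + 1/25 + (1/25)\<^sup>2" by (rule exp_bound) auto
  finally have s: "s \<le> 21/20" by (simp add: power2_eq_square)
  have s1: "1 \<le> s" unfolding s_def a_def by simp
  have power: "exp (- 4 * L * (card A + card B)) = a ^ card A * a ^ card B" for A B :: "'a set"
    unfolding a_def by (simp add: algebra_simps flip: exp_of_nat_mult exp_add)
  have "(\<Sum>(A, B)\<in>(Pow V - {{}}) \<times> Pow V. exp (- 4 * L * (card A + card B)))
      = (\<Sum>A\<in>Pow V - {{}}. a ^ card A) * (\<Sum>B\<in>Pow V. a ^ card B)"
    unfolding power by (simp add: sum_product sum.cartesian_product)
  also have "(\<Sum>A\<in>Pow V - {{}}. a ^ card A) = s - 1"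
    using sum_Pow_power_card[OF V(1), of a] V(1) by (simp add: sum_diff1 s_def)
  also have "(\<Sum>B\<in>Pow V. a ^ card B) = s" using sum_Pow_power_card[OF V(1), of a] by (simp add: s_def)
  also have "(s - 1) * s \<le> (1/20) * (21/20)" using s s1 by (intro mult_mono) auto
  finally have 1: "(\<Sum>(A, B)\<in>(Pow V - {{}}) \<times> Pow V. exp (- 4 * L * (card A + card B))) \<le> 21/400" by simp
  have "(\<Sum>(A, B)\<in>(Pow V - {{}}) \<times> Pow V. exp (- 4 * real ?n)) \<le> (\<Sum>(A, B)\<in>Pow V \<times> Pow V. exp (- 4 * real ?n))"
    using V by (intro sum_mono2) auto
  also have "\<dots> = (2 ^ ?n * 2 ^ ?n) * exp (- 4) ^ ?n"
    using V by (simp add: card_cartesian_product card_Pow mult.commute flip: exp_of_nat_mult)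
  also have "\<dots> = (4 * exp (- 4 :: real)) ^ ?n"
    by (simp only: power_mult_distrib[symmetric]) simp
  also have "\<dots> \<le> (1/4) ^ ?n"
  proof (rule power_mono)
    have "(1 + 1) ^ 4 \<le> exp (1::real) ^ 4" by (intro power_mono) (use exp_ge_add_one_self[of 1] in auto)
    then have "16 \<le> exp (4::real)" by (simp flip: exp_of_nat_mult)
    then show "4 * exp (- 4) \<le> (1/4 :: real)" by (simp add: exp_minus field_simps)
  qed auto
  also have "\<dots> \<le> (1/4) ^ 1" using n by (intro power_decreasing) auto
  finally have 2: "(\<Sum>(A, B)\<in>(Pow V - {{}}) \<times> Pow V. exp (- 4 * real ?n)) \<le> 1/4" by simp
  show ?thesis using 1 2 by (simp add: case_prod_unfold sum.distrib)
qed

text \<open>\<open>small\<close> ensures that deleting linking paths costs at most half of the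
  exponent in the failure probability. \<open>gap\<close> leaves enough vertices outside
  \<open>X\<close> and its would-be small neighbourhood when \<open>X\<close> is nearly of threshold
  size; it also yields \<open>L \<ge> 8\<close>.\<close>

lemma link_free_expander:
  fixes d D L :: real and V :: "'v set"
  assumes V: "finite V" "card V = n" and g: "inj_on g V"
    and r: "1 \<le> r" and d: "1 \<le> d"
    and L: "L = ln n" and D: "D = 64 * d * L"
    and small: "4 * real r * real (Suc r) * 2 ^ Suc r * D ^ r \<le> n"
    and gap: "8 \<le> (1 - 1 / d) * L"
  obtains G where "expander n d G" "verts G = V" "edges G \<subseteq> admissible_pairs g V"
    "\<And>P. P \<in> linking_paths g V (Suc r) \<Longrightarrow> \<not> P \<subseteq> edges G"
proof -
  define m where "m = expander_threshold n d"
  define p where "p = D / n"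
  let ?E = "admissible_pairs g V"
  let ?Q = "cross_pairs g V"
  define \<P> where "\<P> = {P \<in> linking_paths g V (Suc r). P \<subseteq> ?E}"
  have "(1 - 1 / d) * L \<le> L"
  proof (cases "0 \<le> L")
    case False
    have "(1 - 1 / d) * L \<le> 0" using d False by (intro mult_nonneg_nonpos) auto
    then show ?thesis using gap by simp
  qed (use d in \<open>simp add: mult_left_le_one_le\<close>)
  then have L8: "8 \<le> L" using gap by simp
  then have n0: "0 < real n" using L by (cases "n = 0") auto
  then have Vne: "V \<noteq> {}" using V(2) by auto
  have "L < n" unfolding L using ln_less_self n0 by blast
  have dD: "512 * d \<le> D" using d L8 D by simp
  then have D1: "1 \<le> D" using d by simp
  have "32 * D \<le> 4 * real r * real (Suc r) * 2 ^ Suc r * D ^ r"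
  proof -
    have "4 * 1 * 2 * 2 ^ Suc 1 * D ^ 1 \<le> 4 * real r * real (Suc r) * 2 ^ Suc r * D ^ r"
      using r D1 by (intro mult_mono power_increasing) auto
    then show ?thesis by simp
  qed
  then have Dn: "32 * D \<le> n" using small by (rule order_trans)
  have p: "0 < p" "p \<le> 1/2" using D1 Dn n0 by (auto simp: p_def field_simps)
  have finE: "finite ?E"
    by (rule finite_subset[of _ "Pow V"]) (use V(1) admissible_pairsD in auto)
  have QE: "?Q X Y \<subseteq> ?E" for X Y by (auto simp: cross_pairs_def)
  \<comment> \<open>The divisor 4 combines the half of the exponent lost in
    \<open>captured_weight\<close> with the half of the cross pairs that may be
    inadmissible.\<close>
  have weight: "(\<Sum>S | S \<subseteq> ?E \<and> captured \<P> (?Q X Y) S. bernoulli_weight p ?E S)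
      \<le> exp (- (p * card X * card Y / 4))"
    if XY: "X \<subseteq> V" "Y \<subseteq> V" "X \<inter> Y = {}" "4 \<le> card Y" for X Y
  proof -
    let ?c = "card (?Q X Y)"
    have "(\<Sum>P | P \<in> \<P> \<and> P \<inter> ?Q X Y \<noteq> {}. p ^ card P)
        \<le> (\<Sum>P | P \<in> linking_paths g V (Suc r) \<and> P \<inter> ?Q X Y \<noteq> {}. p ^ card P)"
    proof (rule sum_mono2)
      show "finite {P \<in> linking_paths g V (Suc r). P \<inter> ?Q X Y \<noteq> {}}"
        by (rule finite_subset[of _ "Pow (Pow V)"])
          (use V(1) in \<open>auto simp: linking_paths_def path_edges_def image_subset_iff\<close>)
    qed (use p in \<open>auto simp: \<P>_def\<close>)
    also have "\<dots> \<le> 2 * real r * real (Suc r) * D ^ r / n * (p * ?c)"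
      unfolding V(2)[symmetric]
    proof (rule linking_paths_weight[OF V(1) Vne g])
      show "finite (?Q X Y)" using finE QE by (rule finite_subset[rotated])
      show "card e = 2" if "e \<in> ?Q X Y" for e
        using that QE admissible_pairsD by blast
    qed (use D1 V(2) in \<open>auto simp: p_def\<close>)
    finally have "2 ^ Suc r * (\<Sum>P | P \<in> \<P> \<and> P \<inter> ?Q X Y \<noteq> {}. p ^ card P)
        \<le> 2 ^ Suc r * (2 * real r * real (Suc r) * D ^ r / n * (p * ?c))"
      by (rule mult_left_mono) simp
    also have "\<dots> = (4 * real r * real (Suc r) * 2 ^ Suc r * D ^ r) / n * (p * ?c / 2)"
    proof -
      have "t * (2 * a * b * c / k * (q * e)) = (4 * a * b * t * c) / k * (q * e / 2)"
        for t a b c k q e :: real by simp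
      then show ?thesis .
    qed
    also have "\<dots> \<le> 1 * (p * ?c / 2)"
      using small n0 p by (intro mult_right_mono) auto
    finally have "(\<Sum>S | S \<subseteq> ?E \<and> captured \<P> (?Q X Y) S. bernoulli_weight p ?E S) \<le> exp (- (p * ?c / 2))"
      using p finE QE
      by (intro captured_weight[where s="Suc r"]) (auto simp: \<P>_def linking_paths_def card_path_edges)
    also have "\<dots> \<le> exp (- (p * card X * card Y / 4))"
    proof -
      have "real (card X * card Y) \<le> real (2 * ?c)"
        using card_cross_pairs_ge[OF V(1) g XY] by (rule of_nat_mono)
      then have "p * (card X * card Y) \<le> p * (2 * ?c)" using p by (intro mult_left_mono) auto
      then show ?thesis by simp
    qed
    finally show ?thesis .
  qed
  \<comment> \<open>The index \<open>(True, X, Z)\<close> stands for a violation of joinedness by \<open>X\<close> and \<open>Z\<close>, and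
    \<open>(False, X, Z)\<close> for a violation of expansion by \<open>X\<close> with neighbourhood \<open>Z\<close>. Enumerating the
    neighbourhood instead of its complement keeps the number of indices small.\<close>
  define I where "I = {(b, X, Z). X \<subseteq> V \<and> X \<noteq> {} \<and> Z \<subseteq> V - X \<and>
    (if b then card X = m \<and> card Z = m else card X < m \<and> card Z < d * card X)}"
  define Qf where "Qf = (\<lambda>(b, X, Z). ?Q X (if b then Z else V - X - Z))"
  \<comment> \<open>The first term is summable because it decays with the sizes of both sets. The
    second serves large \<open>X\<close> in the expansion case, where counting all pairs of sets is
    affordable.\<close>
  define w where "w = (\<lambda>(b :: bool, X :: 'v set, Z :: 'v set). exp (- 4 * L * (card X + card Z)) + exp (- 4 * real n))"
  have bound: "(\<Sum>S | S \<subseteq> ?E \<and> captured \<P> (Qf i) S. bernoulli_weight p ?E S) \<le> w i" if "i \<in> I" for i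
  proof -
    obtain b X Z where i: "i = (b, X, Z)" by (cases i) auto
    have X: "X \<subseteq> V" "X \<noteq> {}" "Z \<subseteq> V - X" using \<open>i \<in> I\<close> by (auto simp: I_def i)
    have fin: "finite X" "finite Z" using X V(1) by (auto intro: finite_subset)
    define x z where "x = real (card X)" and "z = real (card Z)"
    have x1: "1 \<le> x" using fin X by (simp add: x_def Suc_le_eq card_gt_0_iff)
    have w: "w i = exp (- (4 * L * (x + z))) + exp (- (4 * real n))" by (simp add: w_def i x_def z_def)
    show ?thesis
    proof (cases b)
      case True
      have mX: "x = m" "z = m" using \<open>i \<in> I\<close> True by (auto simp: I_def i x_def z_def)
      have m: "n / (2 * d) \<le> m" unfolding m_def expander_threshold_def by linarith
      have "4 \<le> n / (2 * d)" using Dn dD d by (simp add: field_simps)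
      then have "4 \<le> card Z" using m mX(2) by (simp add: z_def)
      then have "(\<Sum>S | S \<subseteq> ?E \<and> captured \<P> (Qf i) S. bernoulli_weight p ?E S) \<le> exp (- (p * x * z / 4))"
        using weight[of X Z] X True by (auto simp: Qf_def i x_def z_def)
      also have "\<dots> \<le> exp (- (4 * L * (x + z)))"
      proof -
        \<comment> \<open>Both sides equal \<open>8 * L * m\<close>. The factor 64 in
          \<open>D\<close> gives equality here and in the corresponding step for small
          \<open>X\<close> below.\<close>
        have "4 * L * (x + z) = p * x * (n / (2 * d)) / 4"
          using n0 d by (simp add: mX p_def D field_simps)
        also have "\<dots> \<le> p * x * z / 4"
          using m p x1 by (intro divide_right_mono mult_left_mono) (auto simp: mX)
        finally show ?thesis by simp
      qed
      finally show ?thesis unfolding w by (simp add: add_increasing2)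
    next
      case False
      let ?Y = "V - X - Z"
      define y where "y = real (card ?Y)"
      have "card X < m" and z: "z < d * x" using \<open>i \<in> I\<close> False by (auto simp: I_def i x_def z_def)
      then have x: "x < n / (2 * d)" unfolding m_def expander_threshold_def x_def by linarith
      then have dx: "d * x < n / 2" using d by (simp add: field_simps)
      have "card V = card X + card Z + card ?Y"
      proof -
        have "card (V - X) = card V - card X" "card X \<le> card V"
          "card ?Y = card (V - X) - card Z" "card Z \<le> card (V - X)"
          using X fin V(1) by (auto intro: card_Diff_subset card_mono)
        then show ?thesis by linarith
      qed
      then have y: "y = n - x - z" unfolding x_def y_def z_def V(2) by simp
      have res: "(\<Sum>S | S \<subseteq> ?E \<and> captured \<P> (Qf i) S. bernoulli_weight p ?E S) \<le> exp (- (p * x * y / 4))"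
        if "4 \<le> y"
        using weight[of X ?Y] X that False by (auto simp: Qf_def i x_def y_def)
      \<comment> \<open>As long as \<open>d * x \<le> n / 4\<close>, the set \<open>?Y\<close>
        contains half of all vertices. For larger \<open>x\<close> it may shrink to about
        \<open>(1 - 1 / d) * n / 2\<close>, and \<open>gap\<close> is what keeps this large
        enough.\<close>
      show ?thesis
      proof (cases "x \<le> n / (4 * d)")
        case True
        then have "d * x \<le> n / 4" using d by (simp add: field_simps)
        moreover have "x \<le> d * x" using d x1 by simp
        ultimately have y2: "n / 2 \<le> y" and xz: "x + z \<le> 2 * (d * x)" using z y by auto
        have "4 * L * (x + z) \<le> 4 * L * (2 * (d * x))"
          using xz L8 by (intro mult_left_mono) auto
        also have "\<dots> = p * x * (n / 2) / 4" using n0 by (simp add: p_def D field_simps)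
        also have "\<dots> \<le> p * x * y / 4"
          using y2 p x1 by (intro divide_right_mono mult_left_mono) auto
        finally have "exp (- (p * x * y / 4)) \<le> exp (- (4 * L * (x + z)))" by simp
        moreover have "4 \<le> y" using y2 Dn dD d by simp
        ultimately show ?thesis using res unfolding w by (smt (verit) exp_gt_zero)
      next
        case False
        have "x + z < n / (2 * d) + n / 2" using x z dx by linarith
        then have "n / 2 * (1 - 1 / d) \<le> y" unfolding y using d by (simp add: field_simps)
        then have "n / 2 * (1 - 1 / d) * L \<le> y * L" using L8 by (intro mult_right_mono) auto
        moreover have "n / 2 * 8 \<le> n / 2 * ((1 - 1 / d) * L)" using gap by (intro mult_left_mono) auto
        ultimately have yL: "4 * n \<le> y * L" by (simp add: mult.assoc)
        have "4 * L \<le> y * L" using yL \<open>L < n\<close> by linarith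
        then have y4: "4 \<le> y" using L8 by simp
        have "4 * n \<le> 4 * (y * L)" using yL by simp
        also have "\<dots> = p * (n / (4 * d)) * y / 4" using n0 d by (simp add: p_def D field_simps)
        also have "\<dots> \<le> p * x * y / 4"
          using False p y4 by (intro divide_right_mono mult_right_mono mult_left_mono) auto
        finally have "exp (- (p * x * y / 4)) \<le> exp (- (4 * real n))" by simp
        then show ?thesis using res[OF y4] unfolding w by (smt (verit) exp_gt_zero)
      qed
    qed
  qed
  have finI: "finite I"
    by (rule finite_subset[of _ "UNIV \<times> Pow V \<times> Pow V"]) (use V(1) in \<open>auto simp: I_def\<close>)
  have sumI: "(\<Sum>i\<in>I. w i) < 1"
  proof -
    let ?J = "(Pow V - {{}}) \<times> Pow V"
    \<comment> \<open>All size constraints in \<open>I\<close> are dropped; the two values of the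
      flag double the sum.\<close>
    have "(\<Sum>i\<in>I. w i) \<le> (\<Sum>i\<in>(UNIV :: bool set) \<times> ?J. w i)"
      using V(1) by (intro sum_mono2) (auto simp: I_def w_def add_nonneg_nonneg)
    also have "\<dots> = 2 * (\<Sum>(A, B)\<in>?J. exp (- 4 * L * (card A + card B)) + exp (- 4 * card V))"
    proof -
      have "(\<Sum>i\<in>(UNIV :: bool set) \<times> ?J. w i) = (\<Sum>b\<in>UNIV. \<Sum>j\<in>?J. w (b, j))"
        by (simp only: sum.cartesian_product) (simp add: case_prod_unfold)
      also have "\<dots> = (\<Sum>j\<in>?J. w (False, j)) + (\<Sum>j\<in>?J. w (True, j))"
        by (simp add: UNIV_bool)
      finally show ?thesis by (simp add: w_def V(2) case_prod_unfold del: sum.cartesian_product)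
    qed
    also have "\<dots> < 1" using union_bound_weights[OF V(1) Vne _ L8] L V(2) by simp
    finally show ?thesis .
  qed
  have "0 \<le> p" "p \<le> 1" using p by auto
  then obtain S where S: "S \<subseteq> ?E" "\<And>i. i \<in> I \<Longrightarrow> \<not> captured \<P> (Qf i) S"
    by (rule exists_uncaptured[OF finE finI _ _ bound sumI]) (assumption, rule that, auto)
  have finS: "finite S" using S(1) finE by (rule finite_subset)
  have ne: "{} \<notin> \<P>"
  proof
    assume "{} \<in> \<P>"
    then obtain h :: "nat \<Rightarrow> 'v" and l where h: "{} = path_edges h l" "2 \<le> l" "inj_on h {..l}"
      unfolding \<P>_def linking_paths_def by blast
    have "card (path_edges h l) = l" using h(3) by (rule card_path_edges)
    then show False unfolding h(1)[symmetric] using h(2) by simp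
  qed
  obtain F where F: "F \<subseteq> S" "\<And>i. i \<in> I \<Longrightarrow> F \<inter> Qf i \<noteq> {}" "\<And>P. P \<in> \<P> \<Longrightarrow> \<not> P \<subseteq> F"
    by (rule prune_uncaptured[OF finS ne S(2)]) (assumption, rule that, auto)
  let ?G = "\<lparr>verts = V, edges = F\<rparr>"
  have FE: "F \<subseteq> ?E" using F(1) S(1) by blast
  have edge: "\<exists>x\<in>X. \<exists>y\<in>Y. {x, y} \<in> F" if YI: "(b, X, Z) \<in> I" "Y = (if b then Z else V - X - Z)" for b X Y Z
  proof -
    obtain e where "e \<in> F" "e \<in> ?Q X Y" using F(2)[OF YI(1)] by (auto simp: Qf_def YI(2))
    then show ?thesis unfolding cross_pairs_def by blast
  qed
  have "expander n d ?G"
    unfolding expander_def m_def[symmetric]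
  proof (intro conjI allI impI)
    have "F \<subseteq> {e. e \<subseteq> V \<and> card e = 2}" using FE admissible_pairsD by blast
    then show "simple_graph ?G" using V(1) by (simp add: simple_graph_def)
    show "card (verts ?G) = n" using V(2) by simp
  next
    fix X assume X: "X \<subseteq> verts ?G" "1 \<le> card X \<and> card X < m"
    let ?N = "neighbourhood ?G X"
    show "d * card X \<le> card ?N"
    proof (rule ccontr)
      assume "\<not> ?thesis"
      then have "(False, X, ?N) \<in> I" using X by (auto simp: I_def neighbourhood_def)
      then obtain x y where "x \<in> X" "y \<in> V - X - ?N" "{x, y} \<in> F" using edge[OF _ refl] by fastforce
      then show False by (auto simp: neighbourhood_def)
    qed
  next
    fix X Y assume XY: "X \<subseteq> verts ?G" "Y \<subseteq> verts ?G" "X \<inter> Y = {} \<and> card X = m \<and> card Y = m"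
    have "0 < n / (2 * d)" using n0 d by simp
    then have "0 < m" unfolding m_def expander_threshold_def by simp
    then have "(True, X, Y) \<in> I" using XY by (auto simp: I_def)
    then obtain x y where xy: "x \<in> X" "y \<in> Y" "{x, y} \<in> F" using edge[OF _ refl] by fastforce
    have "finite {(x, y). x \<in> X \<and> y \<in> Y \<and> {x, y} \<in> edges ?G}"
      by (rule finite_subset[of _ "V \<times> V"]) (use XY V(1) in auto)
    then show "0 < edge_count ?G X Y" using xy by (auto simp: edge_count_def card_gt_0_iff)
  qed
  moreover have "\<not> P \<subseteq> F" if "P \<in> linking_paths g V (Suc r)" for P
    using F(3)[of P] FE that by (auto simp: \<P>_def)
  ultimately show thesis using that[of ?G] FE by simp
qed

subsection \<open>Heap-shaped trees\<close>

text \<open>Level-by-level numbering of a \<open>b\<close>-ary tree, as in an array heap: the root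
  is 0, the children of \<open>v\<close> are \<open>v * b + 1\<close> to \<open>v * b + b\<close>,
  and parents have smaller numbers than their children.\<close>

definition heap_tree :: "nat \<Rightarrow> nat \<Rightarrow> nat graph" where
  "heap_tree b n = \<lparr>verts = {..<n}, edges = {{i, (i - 1) div b} | i. 1 \<le> i \<and> i < n}\<rparr>"

lemma verts_heap_tree [simp]: "verts (heap_tree b n) = {..<n}"
  by (simp add: heap_tree_def)

lemma heap_parent_less: "1 \<le> i \<Longrightarrow> (i - 1) div b < (i :: nat)"
  using div_le_dividend[of "i - 1" b] by linarith

lemma heap_tree_edge_iff:
  "{u, v} \<in> edges (heap_tree b n) \<longleftrightarrow>
     1 \<le> u \<and> u < n \<and> v = (u - 1) div b \<or> 1 \<le> v \<and> v < n \<and> u = (v - 1) div b"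
  by (auto simp: heap_tree_def doubleton_eq_iff)

lemma simple_graph_heap_tree: "simple_graph (heap_tree b n)"
proof -
  have "e \<subseteq> {..<n} \<and> card e = 2" if "e \<in> edges (heap_tree b n)" for e
  proof -
    from that obtain i where i: "e = {i, (i - 1) div b}" "1 \<le> i" "i < n"
      by (auto simp: heap_tree_def)
    then show ?thesis using heap_parent_less[OF i(2), of b] by auto
  qed
  then show ?thesis by (auto simp: simple_graph_def heap_tree_def)
qed

lemma connected_heap_tree:
  assumes "1 \<le> n"
  shows "connected_graph (heap_tree b n)"
proof -
  let ?R = "{(x, y). {x, y} \<in> edges (heap_tree b n)}"
  have "sym ?R" by (auto simp: sym_def insert_commute)
  then have sym: "sym (?R\<^sup>*)" by (rule sym_rtrancl)
  have root: "(u, 0) \<in> ?R\<^sup>*" if "u < n" for u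
    using that
  proof (induction u rule: less_induct)
    case (less u)
    show ?case
    proof (cases "u = 0")
      case False
      then have "(u, (u - 1) div b) \<in> ?R" using less.prems by (simp add: heap_tree_edge_iff)
      moreover have "((u - 1) div b, 0) \<in> ?R\<^sup>*"
        using False less heap_parent_less[of u b] by simp
      ultimately show ?thesis by (rule converse_rtrancl_into_rtrancl)
    qed simp
  qed
  have "(u, v) \<in> ?R\<^sup>*" if "u < n" "v < n" for u v
    using root[OF that(1)] symD[OF sym root[OF that(2)]] by (rule rtrancl_trans)
  then show ?thesis
    using assms unfolding connected_graph_def verts_heap_tree by (auto simp: lessThan_empty_iff)
qed

text \<open>Both cycle neighbours of the largest vertex of a cycle would be its parent.\<close>

lemma acyclic_heap_tree: "\<not> is_cycle (heap_tree b n) q"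
proof
  assume "is_cycle (heap_tree b n) q"
  then have q: "3 \<le> length q" "distinct q"
    and edge: "\<And>i. i < length q \<Longrightarrow> {q ! i, q ! (Suc i mod length q)} \<in> edges (heap_tree b n)"
    by (auto simp: is_cycle_def)
  let ?k = "length q"
  let ?M = "Max (set q)"
  have "?M \<in> set q" using q by (intro Max_in) auto
  then obtain i where i: "i < ?k" "q ! i = ?M" by (auto simp: in_set_conv_nth)
  have le: "q ! j \<le> q ! i" if "j < ?k" for j using that unfolding i(2) by simp
  have parent: "q ! j = (q ! i - 1) div b"
    if "j < ?k" "{q ! i, q ! j} \<in> edges (heap_tree b n)" for j
    using that(2) le[OF that(1)] heap_parent_less[of "q ! j" b] unfolding heap_tree_edge_iff by linarith
  define s where "s = Suc i mod ?k"
  \<comment> \<open>The cyclic predecessor of \<open>i\<close>; adding \<open>?k - 1\<close> instead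
    of subtracting 1 also covers \<open>i = 0\<close>.\<close>
  define t where "t = (i + (?k - 1)) mod ?k"
  have "0 < ?k" using q(1) by linarith
  then have st: "s < ?k" "t < ?k" unfolding s_def t_def by (rule mod_less_divisor)+
  have "Suc t mod ?k = Suc (i + (?k - 1)) mod ?k" by (simp add: t_def mod_Suc_eq)
  also have "Suc (i + (?k - 1)) = i + ?k" using q(1) by linarith
  also have "(i + ?k) mod ?k = i" using i(1) by simp
  finally have tS: "Suc t mod ?k = i" .
  have "q ! s = (q ! i - 1) div b" using st(1) edge[OF i(1)] by (intro parent) (auto simp: s_def)
  moreover have "q ! t = (q ! i - 1) div b"
    using st(2) edge[OF st(2)] unfolding tS by (intro parent) (auto simp: insert_commute)
  ultimately have "s = t" using q(2) st nth_eq_iff_index_eq by metis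
  \<comment> \<open>Two steps along the cycle would return to \<open>i\<close>, impossible for
    length at least 3.\<close>
  then have "Suc (Suc i mod ?k) mod ?k = i" using tS by (simp add: s_def)
  then have "Suc (Suc i) mod ?k = i" by (simp add: mod_Suc_eq)
  moreover have "Suc (Suc i) mod ?k = Suc (Suc i) - (if Suc (Suc i) < ?k then 0 else ?k)"
    using i(1) q(1) by (simp add: mod_if)
  ultimately show False using i(1) q(1) by (simp split: if_splits)
qed

lemma max_degree_heap_tree_le:
  assumes "1 \<le> b" "1 \<le> n"
  shows "max_degree (heap_tree b n) \<le> b + 1"
proof -
  have "degree (heap_tree b n) v \<le> b + 1" for v
  proof -
    \<comment> \<open>For \<open>v = 0\<close> truncated subtraction makes the supposed parent 0,
      which merely enlarges the covering set.\<close>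
    have "{w \<in> verts (heap_tree b n). {v, w} \<in> edges (heap_tree b n)}
        \<subseteq> insert ((v - 1) div b) {v * b + 1..v * b + b}" (is "?N \<subseteq> ?C")
    proof
      fix w assume "w \<in> ?N"
      then consider "w = (v - 1) div b" | "1 \<le> w" "v = (w - 1) div b"
        by (auto simp: heap_tree_edge_iff)
      then show "w \<in> ?C"
      proof cases
        case 2
        have "(w - 1) div b * b + (w - 1) mod b = w - 1" by simp
        moreover have "(w - 1) mod b < b" using assms(1) by simp
        ultimately have "v * b \<le> w - 1 \<and> w - 1 < v * b + b" unfolding 2(2) by linarith
        then have "w \<in> {v * b + 1..v * b + b}" using 2(1) by auto
        then show ?thesis by blast
      qed simp
    qed
    then have "card ?N \<le> card ?C" by (intro card_mono) auto
    also have "\<dots> \<le> b + 1" by (simp add: card_insert_if)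
    finally show ?thesis by (simp add: degree_def)
  qed
  then show ?thesis using assms(2) by (auto simp: max_degree_def heap_tree_def lessThan_empty_iff)
qed

lemma heap_tree_in_bounded_degree_trees:
  assumes "1 \<le> b" "1 \<le> n" "real b + 1 \<le> \<Delta>"
  shows "heap_tree b n \<in> bounded_degree_trees n \<Delta>"
  using assms simple_graph_heap_tree connected_heap_tree acyclic_heap_tree
    max_degree_heap_tree_le[OF assms(1,2)]
  by (auto simp: bounded_degree_trees_def is_tree_def heap_tree_def)

text \<open>Passing to the parent \<open>(y - 1) div b\<close> lowers the exponent in
  \<open>y < b ^ s\<close> by one, so induction on \<open>s\<close> applies. The increasing labels
  record that the path repeats no vertex.\<close>

lemma heap_tree_path_from_root:
  assumes "y < b ^ s" "y < n"
  shows "\<exists>l h. l \<le> s \<and> h 0 = 0 \<and> h l = y \<and> (\<forall>i<l. h i < h (Suc i)) \<and>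
    (\<forall>i<l. {h i, h (Suc i)} \<in> edges (heap_tree b n))"
  using assms
proof (induction s arbitrary: y)
  case 0
  then show ?case by (intro exI[of _ 0] exI[of _ "\<lambda>_. 0"]) auto
next
  case (Suc s)
  show ?case
  proof (cases "y = 0")
    case True
    then show ?thesis by (intro exI[of _ 0] exI[of _ "\<lambda>_. 0"]) auto
  next
    case False
    then have less: "(y - 1) div b < y" by (intro heap_parent_less) simp
    have lt: "(y - 1) div b < b ^ s"
      using Suc.prems(1) by (simp add: less_mult_imp_div_less mult.commute)
    obtain l h where h: "l \<le> s" "h 0 = 0" "h l = (y - 1) div b"
      "\<forall>i<l. h i < h (Suc i)" "\<forall>i<l. {h i, h (Suc i)} \<in> edges (heap_tree b n)"
      using Suc.IH[OF lt less_trans[OF less Suc.prems(2)]] by (elim exE conjE) (rule that)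
    let ?h = "h(Suc l := y)"
    have "{(y - 1) div b, y} \<in> edges (heap_tree b n)"
      using False Suc.prems(2) by (simp add: heap_tree_edge_iff)
    then have "\<forall>i<Suc l. ?h i < ?h (Suc i)" "\<forall>i<Suc l. {?h i, ?h (Suc i)} \<in> edges (heap_tree b n)"
      using h less by (auto simp: less_Suc_eq)
    then show ?thesis using h by (intro exI[of _ "Suc l"] exI[of _ ?h]) auto
  qed
qed

subsection \<open>Non-universality\<close>

lemma inj_on_Suc_mod: "inj_on (\<lambda>v. Suc v mod n) {..<n}"
proof (rule inj_onI)
  fix u v assume uv: "u \<in> {..<n}" "v \<in> {..<n}" "Suc u mod n = Suc v mod n"
  then show "u = v" by (cases "Suc u = n"; cases "Suc v = n") auto
qed

lemma Suc_mod_neq: "2 \<le> n \<Longrightarrow> v < n \<Longrightarrow> Suc v mod n \<noteq> (v :: nat)"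
  by (cases "Suc v = n") auto

text \<open>A copy uses all \<open>n\<close> vertices of \<open>G\<close>, so \<open>g (f 0)\<close>
  is the image of some \<open>y\<close>. The short path from the root to \<open>y\<close> is mapped
  to a linking path from \<open>f 0\<close> to \<open>g (f 0)\<close>. Length 0 is excluded by
  \<open>g v \<noteq> v\<close> and length 1 by admissibility.\<close>

lemma not_contains_heap_tree:
  fixes G :: "nat graph"
  assumes n: "2 \<le> n" "n \<le> b ^ Suc r"
    and G: "verts G = {..<n}" "edges G \<subseteq> admissible_pairs g {..<n}"
    and g: "\<And>v. v < n \<Longrightarrow> g v < n \<and> g v \<noteq> v"
    and free: "\<And>P. P \<in> linking_paths g {..<n} (Suc r) \<Longrightarrow> \<not> P \<subseteq> edges G"
  shows "\<not> contains_copy G (heap_tree b n)"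
proof
  assume "contains_copy G (heap_tree b n)"
  then obtain f where f: "inj_on f {..<n}" "f ` {..<n} \<subseteq> {..<n}"
    and edge: "\<And>e. e \<in> edges (heap_tree b n) \<Longrightarrow> f ` e \<in> edges G"
    using G(1) by (auto simp: contains_copy_def)
  have f0: "f 0 < n" using f(2) n(1) by (auto simp: image_subset_iff)
  have surj: "f ` {..<n} = {..<n}" using f by (intro endo_inj_surj) auto
  moreover have "g (f 0) \<in> {..<n}" using g[OF f0] by simp
  ultimately obtain y where y: "y < n" "f y = g (f 0)" by (metis imageE lessThan_iff)
  have yb: "y < b ^ Suc r" using y(1) n(2) by (rule less_le_trans)
  obtain l h where h: "l \<le> Suc r" "h 0 = 0" "h l = y"
    "\<forall>i<l. h i < h (Suc i)" "\<forall>i<l. {h i, h (Suc i)} \<in> edges (heap_tree b n)"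
    using heap_tree_path_from_root[OF yb y(1)] by (elim exE conjE) (rule that)
  \<comment> \<open>Monotone labels make \<open>h\<close> injective and keep every vertex of the
    path at most \<open>y\<close>, hence below \<open>n\<close>.\<close>
  have less: "i < j \<Longrightarrow> j \<le> l \<Longrightarrow> h i < h j" for i j
  proof (induction j)
    case (Suc j)
    have "h j < h (Suc j)" using h(4) Suc.prems(2) by simp
    moreover have "h i \<le> h j" using Suc by (cases "i = j") auto
    ultimately show ?case by simp
  qed simp
  have "inj_on h {..l}"
    by (rule linorder_inj_onI) (use less in fastforce)+
  moreover have hV: "h ` {..l} \<subseteq> {..<n}"
  proof
    fix z assume "z \<in> h ` {..l}"
    then obtain i where "i \<le> l" "z = h i" by auto
    then show "z \<in> {..<n}" using less[of i l] h(3) y(1) by (cases "i = l") auto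
  qed
  ultimately have inj: "inj_on (f \<circ> h) {..l}"
    using f(1) by (intro comp_inj_on) (auto intro: inj_on_subset)
  have sub: "path_edges (f \<circ> h) l \<subseteq> edges G"
    using edge h(5) by (fastforce simp: path_edges_def)
  have "l \<noteq> 0" using h(2,3) y(2) g[OF f0] by metis
  moreover have "l \<noteq> 1"
  proof
    assume "l = 1"
    then have "{f 0, g (f 0)} \<in> edges G" using sub h(2,3) y(2) by (auto simp: path_edges_def)
    then show False using G(2) by (auto simp: admissible_pairs_def doubleton_eq_iff)
  qed
  ultimately have "2 \<le> l" by linarith
  moreover have "(f \<circ> h) ` {..l} \<subseteq> {..<n}" using hV f(2) by fastforce
  ultimately have "path_edges (f \<circ> h) l \<in> linking_paths g {..<n} (Suc r)"
    unfolding linking_paths_def using h(1,2,3) y(2) inj by (intro CollectI exI[of _ "f \<circ> h"] exI[of _ l]) auto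
  then show False using free sub by blast
qed

section \<open>Numerical estimates for the parameters\<close>

lemma expander_parameters:
  fixes \<Delta> c k L d D :: real
  assumes n: "2 \<le> n" and r: "1 \<le> r"
    and k: "k = real n powr (1 / (real r + 1))" and \<Delta>: "\<Delta> = k + 2"
    and c: "c = 1 / 2 ^ 14" and L: "L = ln (real n)" and large: "inverse c * L \<le> \<Delta>"
    and d: "d = c * \<Delta> powr (1 + 1 / real r) * inverse L" and D: "D = 64 * d * L"
  shows "1 \<le> d" "4 * real r * real (Suc r) * 2 ^ Suc r * D ^ r \<le> n" "8 \<le> (1 - 1 / d) * L"
    "1 \<le> k" "k ^ Suc r = n"
proof -
  \<comment> \<open>From \<open>L \<ge> 1/2\<close> the hypothesis \<open>large\<close> gives
    \<open>\<Delta> \<ge> 2 ^ 14 / 2 = 8192\<close>, so \<open>k\<close> exceeds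
    \<open>3 ^ 8 = 6561\<close> and \<open>ln k \<ge> 8\<close>.\<close>
  have "ln (1/2) \<le> 1/2 - (1::real)" by (rule ln_le_minus_one) simp
  then have "1/2 \<le> ln (2::real)" by (simp add: ln_div)
  also have "\<dots> \<le> L" unfolding L using n by simp
  finally have L2: "1/2 \<le> L" .
  then have "8192 \<le> \<Delta>" using large by (simp add: c)
  then have k8190: "8190 \<le> k" by (simp add: \<Delta>)
  then show "1 \<le> k" by simp
  have "exp 8 = exp (1::real) ^ 8" by (simp flip: exp_of_nat_mult)
  also have "\<dots> \<le> 3 ^ 8" using exp_le by (intro power_mono) auto
  also have "\<dots> \<le> k" using k8190 by simp
  finally have lk: "8 \<le> ln k" using k8190 by (simp add: ln_ge_iff)
  show kn: "k ^ Suc r = n"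
    using n unfolding k by (simp add: powr_powr flip: powr_realpow del: power_Suc) (simp add: add.commute)
  then have "L = ln (k ^ Suc r)" by (simp add: L)
  then have Lk: "L = (real r + 1) * ln k" using k8190 by (simp add: ln_realpow algebra_simps del: power_Suc)
  \<comment> \<open>Chosen so that \<open>exp u = k powr (1 / r)\<close>. The resulting bound
    \<open>1 + u \<le> d\<close> suffices for \<open>gap\<close>: \<open>1 - 1 / (1 + u)\<close> is
    \<open>ln k / (r + ln k)\<close>, while \<open>L = (r + 1) * ln k\<close> is at least
    \<open>r + ln k\<close>.\<close>
  define u where "u = ln k / real r"
  have u0: "0 < u" using lk r by (simp add: u_def)
  have "1 + u \<le> exp u" by simp
  also have "\<dots> = k powr (1 / real r)" using k8190 by (simp add: u_def powr_def)
  also have "\<dots> \<le> \<Delta> powr (1 / real r)" using k8190 by (intro powr_mono2) (auto simp: \<Delta>)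
  also have "\<dots> \<le> c * \<Delta> / L * \<Delta> powr (1 / real r)"
  proof -
    have "1 \<le> c * \<Delta> / L" using large L2 by (simp add: c field_simps)
    then show ?thesis by (intro mult_le_cancel_right1[THEN iffD2]) auto
  qed
  also have "\<dots> = d" using k8190 \<Delta> by (simp add: d powr_add field_simps)
  finally have du: "1 + u \<le> d" .
  then show "1 \<le> d" using u0 by simp
  have "8 \<le> ln k" by (rule lk)
  also have "ln k \<le> (1 - 1 / (1 + u)) * L"
  proof -
    have "real r + ln k \<le> (real r + 1) * ln k" using lk r by (simp add: algebra_simps)
    then have "(real r + ln k) * ln k \<le> (real r + 1) * ln k * ln k" using lk by (intro mult_right_mono) auto
    then have "ln k \<le> ln k / (real r + ln k) * ((real r + 1) * ln k)"
      using r lk by (simp add: field_simps)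
    also have "ln k / (real r + ln k) = 1 - 1 / (1 + u)"
      using r lk by (simp add: u_def field_simps)
    finally show ?thesis unfolding Lk .
  qed
  also have "\<dots> \<le> (1 - 1 / d) * L"
    using du u0 L2 by (intro mult_right_mono diff_left_mono divide_left_mono) auto
  finally show "8 \<le> (1 - 1 / d) * L" .
  \<comment> \<open>\<open>L\<close> cancels and \<open>64 / 2 ^ 14 = 1/256\<close>. With
    \<open>\<Delta> \<le> 2 * k\<close> and \<open>r * (r + 1) \<le> 4 ^ r\<close>, the remaining
    powers of 2 combine to \<open>16 * (1/16) ^ r\<close>, at most 1 for
    \<open>r \<ge> 1\<close>.\<close>
  have D256: "D = 1/256 * \<Delta> powr (1 + 1 / real r)" using L2 by (simp add: D d c)
  have "D ^ r = (1/256) ^ r * (\<Delta> powr (1 + 1 / real r)) ^ r" unfolding D256 by (simp only: power_mult_distrib)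
  also have "(\<Delta> powr (1 + 1 / real r)) ^ r = \<Delta> powr ((1 + 1 / real r) * real r)"
    using k8190 \<Delta> by (simp add: powr_powr flip: powr_realpow)
  also have "(1 + 1 / real r) * real r = real (Suc r)" using r by (simp add: field_simps)
  also have "\<Delta> powr real (Suc r) = \<Delta> ^ Suc r" using k8190 \<Delta> by (intro powr_realpow) simp
  also have "(1/256) ^ r * \<Delta> ^ Suc r \<le> (1/256) ^ r * (2 * k) ^ Suc r"
    using k8190 by (intro mult_left_mono power_mono) (auto simp: \<Delta>)
  also have "\<dots> = (1/256) ^ r * 2 ^ Suc r * n" by (simp only: power_mult_distrib kn mult.assoc)
  finally have Dr: "D ^ r \<le> (1/256) ^ r * 2 ^ Suc r * n" .
  have "real r * real (Suc r) \<le> 2 ^ r * 2 ^ r"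
  proof (intro mult_mono)
    have "r < 2 ^ r" by (rule less_exp)
    then show "real r \<le> 2 ^ r" "real (Suc r) \<le> 2 ^ r"
      by (metis less_imp_le of_nat_le_iff of_nat_numeral of_nat_power Suc_leI)+
  qed auto
  then have le: "4 * (real r * real (Suc r)) * 2 ^ Suc r \<le> 4 * (2 ^ r * 2 ^ r) * 2 ^ Suc r"
    by (intro mult_right_mono mult_left_mono) auto
  have "0 \<le> D ^ r" unfolding D256 by simp
  then have "4 * (real r * real (Suc r)) * 2 ^ Suc r * D ^ r
      \<le> 4 * (2 ^ r * 2 ^ r) * 2 ^ Suc r * ((1/256) ^ r * 2 ^ Suc r * n)"
    by (intro mult_mono[OF le Dr]) auto
  also have "\<dots> = 16 * (1/16) ^ r * n"
  proof -
    have "(2::real) ^ r * 2 ^ r * 2 ^ r * 2 ^ r * (1/256) ^ r = (1/16) ^ r"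
      by (simp only: power_mult_distrib[symmetric]) simp
    then show ?thesis by (simp add: mult_ac)
  qed
  also have "\<dots> \<le> 16 * (1/16) ^ 1 * n"
    using r by (intro mult_right_mono mult_left_mono power_decreasing) auto
  finally show "4 * real r * real (Suc r) * 2 ^ Suc r * D ^ r \<le> n" by (simp add: mult.assoc)
qed

text \<open>The assumptions \<open>n \<ge> 2\<close> and \<open>r \<ge> 1\<close> keep
  \<open>ln n\<close> positive and the exponent \<open>1 / r\<close> meaningful.\<close>

theorem theorem2p8:
  "\<exists>c::real. c > 0 \<and>
     (\<forall>(n::nat) (r::nat) (\<Delta>::real).
        n \<ge> 2 \<longrightarrow> r \<ge> 1 \<longrightarrow>
        \<Delta> = real n powr (1 / (real r + 1)) + 2 \<longrightarrow>
        \<Delta> \<ge> inverse c * ln (real n) \<longrightarrow>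
        (\<exists>G :: nat graph.
           expander n (c * \<Delta> powr (1 + 1 / real r) * inverse (ln (real n))) G \<and>
           \<not> universal_for G (bounded_degree_trees n \<Delta>)))"
proof (intro exI[of _ "1 / 2 ^ 14"] conjI allI impI)
  fix n r :: nat and \<Delta> :: real
  assume n: "2 \<le> n" and r: "1 \<le> r" and \<Delta>: "\<Delta> = real n powr (1 / (real r + 1)) + 2"
    and large: "inverse (1 / 2 ^ 14) * ln (real n) \<le> \<Delta>"
  define k where "k = real n powr (1 / (real r + 1))"
  define d where "d = 1 / 2 ^ 14 * \<Delta> powr (1 + 1 / real r) * inverse (ln (real n))"
  define b where "b = nat \<lceil>k\<rceil>"
  let ?g = "\<lambda>v. Suc v mod n"
  have \<Delta>k: "\<Delta> = k + 2" by (simp add: \<Delta> k_def)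
  note params = expander_parameters[OF n r k_def \<Delta>k refl refl large d_def refl]
  obtain G where G: "expander n d G" "verts G = {..<n}" "edges G \<subseteq> admissible_pairs ?g {..<n}"
    "\<And>P. P \<in> linking_paths ?g {..<n} (Suc r) \<Longrightarrow> \<not> P \<subseteq> edges G"
    by (rule link_free_expander[OF finite_lessThan card_lessThan inj_on_Suc_mod r params(1) refl refl params(2,3)])
      (rule that)
  \<comment> \<open>Rounding \<open>k\<close> up adds less than 1 and the parent adds 1 to the
    degree; the summand 2 in \<open>\<Delta>\<close> absorbs both.\<close>
  have b: "k \<le> b" "real b + 1 \<le> \<Delta>" "1 \<le> b" using params(4) by (auto simp: b_def \<Delta>k) linarith+
  have "k ^ Suc r \<le> real b ^ Suc r" using b(1) params(4) by (intro power_mono) auto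
  then have "real n \<le> real (b ^ Suc r)" unfolding params(5) by simp
  then have nb: "n \<le> b ^ Suc r" by (simp only: of_nat_le_iff)
  have "\<not> contains_copy G (heap_tree b n)"
    by (rule not_contains_heap_tree[OF n nb G(2,3) _ G(4)]) (use n Suc_mod_neq in auto)
  moreover have "heap_tree b n \<in> bounded_degree_trees n \<Delta>"
    using b n by (intro heap_tree_in_bounded_degree_trees) auto
  ultimately show "\<exists>G :: nat graph. expander n (1 / 2 ^ 14 * \<Delta> powr (1 + 1 / real r) * inverse (ln (real n))) G \<and>
      \<not> universal_for G (bounded_degree_trees n \<Delta>)"
    using G(1) unfolding d_def universal_for_def by blast
qed simp

end
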